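(* Let $C$ be an $(n,k)_2$-MDS code over the alphabet $\{0,1\}$ containing the all-zero codeword $\bar 0$, and let $W(C)$ denote the set of Hamming weights of the codewords of $C$ other than $\bar 0$. Then precisely one of the following holds. (1) $k=1$, and $W(C)=\{n\}$. (2) $n=k>1$, and $W(C)=\{n,n-1,\ldots,1\}$. (3) $n=k+1$, and $W(C)=\{1<t\le n \mid t \text{ is even}\}$.
   Context: Here $n$ and $k$ are integers with $1\le k\le n$. The Hamming distance of $a,b\in\{0,1\}^n$ is the number of coordinates in which they differ. An $(n,k)_2$ code is a subset $C\subseteq\{0,1\}^n$ with $|C|=2^k$; no linearity is assumed. Its minimum distance $d$ is the minimum Hamming distance between distinct codewords; it satisfies $d\le n-k+1$ (the Singleton bound), and $C$ is called an $(n,k)_2$-MDS code if $d=n-k+1$. The Hamming weight of a word is the number of its nonzero coordinates. In (3), $t$ ranges over integers.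
   Formalization: "Precisely one" is proved for all (n,k) except (2,1), where it fails: C={00,11} is MDS with W(C)={2} and satisfies both (1) and (3); for n=2, k=1 it is proved instead that (1) and (3) hold and (2) does not. *)

theory Defs
  imports Main "HOL-Library.Z2"
begin

text \<open>Words of \<open>{0,1}\<^sup>n\<close> are the lists of length \<open>n\<close> over the two-element type \<^typ>\<open>bit\<close>.\<close>

definition words :: "nat \<Rightarrow> bit list set" where
  "words n = {x. length x = n}"

text \<open>Only meant for words of equal length.\<close>

definition hamming_dist :: "bit list \<Rightarrow> bit list \<Rightarrow> nat" where
  "hamming_dist a b = card {i. i < length a \<and> a ! i \<noteq> b ! i}"

definition hamming_weight :: "bit list \<Rightarrow> nat" where
  "hamming_weight a = card {i. i < length a \<and> a ! i \<noteq> 0}"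

definition zero_word :: "nat \<Rightarrow> bit list" where
  "zero_word n = replicate n 0"

definition is_code :: "nat \<Rightarrow> nat \<Rightarrow> bit list set \<Rightarrow> bool" where
  "is_code n k C \<longleftrightarrow> C \<subseteq> words n \<and> card C = 2 ^ k"

text \<open>For an \<open>(n,k)\<close> code with \<open>k \<ge> 1\<close> the set below is finite and nonempty, so
  \<^const>\<open>Min\<close> is its true minimum.\<close>

definition min_distance :: "bit list set \<Rightarrow> nat" where
  "min_distance C = Min {hamming_dist a b | a b. a \<in> C \<and> b \<in> C \<and> a \<noteq> b}"

text \<open>To be used with \<open>1 \<le> k \<le> n\<close>, where the subtraction on natural numbers does not truncate.\<close>

definition is_MDS :: "nat \<Rightarrow> nat \<Rightarrow> bit list set \<Rightarrow> bool" where
  "is_MDS n k C \<longleftrightarrow> is_code n k C \<and> min_distance C = n - k + 1"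

definition nonzero_weights :: "nat \<Rightarrow> bit list set \<Rightarrow> nat set" where
  "nonzero_weights n C = hamming_weight ` (C - {zero_word n})"

definition exactly_one :: "bool \<Rightarrow> bool \<Rightarrow> bool \<Rightarrow> bool" where
  "exactly_one P Q R \<longleftrightarrow> (P \<and> \<not> Q \<and> \<not> R) \<or> (\<not> P \<and> Q \<and> \<not> R) \<or> (\<not> P \<and> \<not> Q \<and> R)"

text \<open>The classification consists of three cases that exclude one another, with a single overlap:
  for \<open>n = 2\<close> and \<open>k = 1\<close> the only MDS code containing the zero word is \<open>{00, 11}\<close>, with weight set \<open>{2}\<close>. It
  satisfies both the case \<open>k = 1\<close> and the case \<open>n = k + 1\<close>, so the
  theorem treats these parameters separately.\<close>

end

(* Since d > n - k, a codeword is determined by its first k letters, so by counting every word of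
   length k is the prefix of a codeword. A codeword whose prefix has weight 1 must have the all-one
   tail to be far enough from the zero word. If k > 1, two such codewords are at distance 2, so
   n - k + 1 \<le> 2. For n = k the code consists of all words; for n = k + 1 flipping one letter of
   the prefix flips the last letter too, so all weights are even. *)

theory Submission
  imports Defs
begin

section \<open>Distance and weight by recursion on lists\<close>

lemma card_Collect_less_Suc:
  "card {i. i < Suc n \<and> P i} = (if P 0 then 1 else 0) + card {i. i < n \<and> P (Suc i)}"
proof -
  \<comment> \<open>Index 0 is separated from the shifted positive indices; this turns the
    cardinalities that define distance and weight into recursive equations for
    \<open>Cons\<close>.\<close>
  have "{i. i < Suc n \<and> P i} = (if P 0 then {0} else {}) \<union> Suc ` {i. i < n \<and> P (Suc i)}"
    by (auto simp: image_iff less_Suc_eq_0_disj)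
  then show ?thesis
    by (auto simp: card_image card_insert_if)
qed

lemma hamming_dist_Nil [simp]: "hamming_dist [] b = 0"
  by (simp add: hamming_dist_def)

lemma hamming_dist_Cons [simp]:
  "hamming_dist (x # a) (y # b) = (if x \<noteq> y then 1 else 0) + hamming_dist a b"
  unfolding hamming_dist_def by (simp add: card_Collect_less_Suc)

lemma hamming_weight_Nil [simp]: "hamming_weight [] = 0"
  by (simp add: hamming_weight_def)

lemma hamming_weight_Cons [simp]:
  "hamming_weight (x # a) = (if x \<noteq> 0 then 1 else 0) + hamming_weight a"
  unfolding hamming_weight_def by (simp add: card_Collect_less_Suc)

lemma hamming_dist_append [simp]:
  "length a = length b \<Longrightarrow>
    hamming_dist (a @ a') (b @ b') = hamming_dist a b + hamming_dist a' b'"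
  by (induction a b rule: list_induct2) simp_all

lemma hamming_dist_self [simp]: "hamming_dist a a = 0"
  by (simp add: hamming_dist_def)

lemma hamming_dist_le_length: "hamming_dist a b \<le> length a"
proof -
  have "hamming_dist a b \<le> card {..<length a}"
    unfolding hamming_dist_def by (intro card_mono) auto
  then show ?thesis by simp
qed

text \<open>Bounds what the prefix contributes after one of its letters is changed, so that a total
  distance of 2 forces the last letters to differ.\<close>

lemma hamming_dist_update_le:
  "hamming_dist u (u[i := x]) \<le> 1"
proof (induction u arbitrary: i)
  case (Cons y u)
  then show ?case by (cases i) auto
qed simp

lemma hamming_weight_append [simp]:
  "hamming_weight (a @ b) = hamming_weight a + hamming_weight b"
  by (induction a) simp_all

lemma hamming_weight_replicate [simp]:
  "hamming_weight (replicate m x) = (if x \<noteq> 0 then m else 0)"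
  by (induction m) simp_all

lemma hamming_weight_le_length: "hamming_weight a \<le> length a"
  by (induction a) auto

lemma hamming_weight_eq_0_iff:
  "hamming_weight a = 0 \<longleftrightarrow> a = zero_word (length a)"
  by (induction a) (auto simp: zero_word_def)

lemma hamming_weight_eq_length_iff:
  "hamming_weight a = length a \<longleftrightarrow> a = replicate (length a) 1"
proof (induction a)
  case (Cons x a)
  then show ?case using hamming_weight_le_length[of a] by auto
qed simp

lemma hamming_dist_zero_word:
  "hamming_dist a (zero_word (length a)) = hamming_weight a"
  by (induction a) (auto simp: zero_word_def)

lemma hamming_weight_clear_bit:
  "i < length u \<Longrightarrow> u ! i = 1 \<Longrightarrow> hamming_weight u = Suc (hamming_weight (u[i := 0]))"
proof (induction u arbitrary: i)
  case (Cons x u)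
  then show ?case by (cases i) auto
qed simp

section \<open>The set of all words\<close>

lemma card_words: "card (words n) = 2 ^ n"
proof -
  have UNIV_bit: "(UNIV :: bit set) = {0, 1}"
    by auto
  have "finite (UNIV :: bit set)" "card (UNIV :: bit set) = 2"
    by (simp_all add: UNIV_bit)
  then show ?thesis
    using card_lists_length_eq[of "UNIV :: bit set" n] by (simp add: words_def)
qed

lemma finite_words: "finite (words n)"
  using card_words[of n] by (intro card_ge_0_finite) simp

lemma words_nonzero_weights:
  assumes "1 \<le> n"
  shows "nonzero_weights n (words n) = {1..n}"
proof (intro equalityI subsetI)
  fix t assume "t \<in> nonzero_weights n (words n)"
  then obtain a where "t = hamming_weight a" "length a = n" "a \<noteq> zero_word n"
    by (auto simp: nonzero_weights_def words_def)
  then show "t \<in> {1..n}"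
    using hamming_weight_eq_0_iff[of a] hamming_weight_le_length[of a]
    by (simp add: Suc_le_eq)
next
  fix t assume t: "t \<in> {1..n}"
  let ?a = "replicate t 1 @ replicate (n - t) (0 :: bit)"
  have "length ?a = n" "hamming_weight ?a = t"
    using t by simp_all
  moreover from this have "?a \<noteq> zero_word n"
    using t hamming_weight_eq_0_iff[of ?a] by auto
  ultimately show "t \<in> nonzero_weights n (words n)"
    unfolding nonzero_weights_def words_def by (auto intro!: image_eqI[of _ _ ?a] simp del: hamming_weight_append)
qed

section \<open>Distances, prefixes and tails in an MDS code\<close>

lemma is_MDS_length: "is_MDS n k C \<Longrightarrow> c \<in> C \<Longrightarrow> length c = n"
  by (auto simp: is_MDS_def is_code_def words_def)

lemma is_MDS_finite: "is_MDS n k C \<Longrightarrow> finite C"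
  unfolding is_MDS_def is_code_def using finite_words finite_subset by blast

lemma is_MDS_dist:
  assumes "is_MDS n k C" "a \<in> C" "b \<in> C" "a \<noteq> b"
  shows "n - k + 1 \<le> hamming_dist a b"
proof -
  let ?D = "{hamming_dist a b | a b. a \<in> C \<and> b \<in> C \<and> a \<noteq> b}"
  \<comment> \<open>\<open>Min_le\<close> needs a finite set; the distances come from the finitely
    many pairs of codewords.\<close>
  have "?D \<subseteq> (\<lambda>(a, b). hamming_dist a b) ` (C \<times> C)"
    by auto
  then have "finite ?D"
    using is_MDS_finite[OF assms(1)] finite_subset by blast
  then have "Min ?D \<le> hamming_dist a b"
    using assms by (intro Min_le) auto
  then show ?thesis
    using assms(1) by (simp add: is_MDS_def min_distance_def)
qed

lemma is_MDS_prefix: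
  assumes C: "is_MDS n k C" and "k \<le> n" and u: "length u = k"
  obtains v where "length v = n - k" "u @ v \<in> C"
proof -
  have "inj_on (take k) C"
  proof (rule inj_onI, rule ccontr)
    fix a b assume *: "a \<in> C" "b \<in> C" "take k a = take k b" "a \<noteq> b"
    have len: "length a = n" "length b = n"
      using C * is_MDS_length by blast+
    have "hamming_dist a b = hamming_dist (take k a @ drop k a) (take k b @ drop k b)"
      by simp
    \<comment> \<open>Equal prefixes contribute nothing, which leaves at most the
      \<open>n - k\<close> positions of the tail, one less than the minimum distance.\<close>
    also have "\<dots> = hamming_dist (drop k a) (drop k b)"
      using * by (subst hamming_dist_append) (simp_all add: len)
    also have "\<dots> \<le> n - k"
      using hamming_dist_le_length[of "drop k a"] len by simp
    finally show False
      using is_MDS_dist[OF C *(1,2,4)] by simp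
  qed
  then have "card (take k ` C) = card (words k)"
    using C by (simp add: card_image card_words is_MDS_def is_code_def)
  moreover have "take k ` C \<subseteq> words k"
    using is_MDS_length[OF C] \<open>k \<le> n\<close> by (auto simp: words_def)
  ultimately have "take k ` C = words k"
    using card_subset_eq[OF finite_words] by blast
  moreover have "u \<in> words k"
    using u by (simp add: words_def)
  ultimately have "u \<in> take k ` C"
    by simp
  then obtain c where c: "c \<in> C" "take k c = u"
    by (elim imageE) simp
  show thesis
  proof
    show "u @ drop k c \<in> C" using c by (metis append_take_drop_id)
    show "length (drop k c) = n - k" using c is_MDS_length[OF C] by simp
  qed
qed

text \<open>The weight of a word is its distance to the zero word, which is itself a
  codeword.\<close>

lemma is_MDS_weight:
  assumes "is_MDS n k C" "zero_word n \<in> C" "c \<in> C" "c \<noteq> zero_word n"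
  shows "n - k + 1 \<le> hamming_weight c"
  using is_MDS_dist[OF assms(1) assms(3,2,4)] is_MDS_length[OF assms(1,3)]
    hamming_dist_zero_word[of c] by simp

lemma is_MDS_prefix_weight_1:
  assumes C: "is_MDS n k C" "zero_word n \<in> C" and "k \<le> n"
    and u: "length u = k" "hamming_weight u = 1"
  shows "u @ replicate (n - k) 1 \<in> C"
proof -
  obtain v where v: "length v = n - k" "u @ v \<in> C"
    using is_MDS_prefix[OF C(1) \<open>k \<le> n\<close> u(1)] .
  have "u @ v \<noteq> zero_word n"
    using u hamming_weight_eq_0_iff[of "u @ v"] v \<open>k \<le> n\<close> by auto
  then have "n - k + 1 \<le> hamming_weight (u @ v)"
    using is_MDS_weight[OF C v(2)] by simp
  \<comment> \<open>The prefix supplies only 1 of the required \<open>n - k + 1\<close>, so every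
    letter of the tail is nonzero.\<close>
  then have "hamming_weight v = length v"
    using u v hamming_weight_le_length[of v] by simp
  then show ?thesis
    using v hamming_weight_eq_length_iff[of v] by simp
qed

lemma is_MDS_length_le:
  assumes C: "is_MDS n k C" "zero_word n \<in> C" and "k \<le> n" "1 < k"
  shows "n \<le> k + 1"
proof -
  \<comment> \<open>\<open>z\<close> fills the prefixes starting with 10 and 01 up to length
    \<open>k\<close>; since \<open>1 < k\<close>, the subtraction does not truncate.\<close>
  define z where "z = replicate (k - 2) (0 :: bit)"
  define w where "w = replicate (n - k) (1 :: bit)"
  have "(1 # 0 # z) @ w \<in> C" "(0 # 1 # z) @ w \<in> C"
    unfolding w_def z_def using C assms(3,4) by (intro is_MDS_prefix_weight_1; simp)+
  then have "n - k + 1 \<le> hamming_dist (1 # 0 # z @ w) (0 # 1 # z @ w)"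
    by (intro is_MDS_dist[OF C(1)]) simp_all
  then show ?thesis by simp
qed

section \<open>Parity of the weights for length k + 1\<close>

lemma is_MDS_even_weight:
  assumes C: "is_MDS (Suc k) k C" "zero_word (Suc k) \<in> C" and "u @ [b] \<in> C"
  shows "even (hamming_weight (u @ [b]))"
  using \<open>u @ [b] \<in> C\<close>
\<comment> \<open>Induction on the weight of the prefix alone: clearing one of its ones lowers this
  by exactly 1, whatever happens to the last letter.\<close>
proof (induction "hamming_weight u" arbitrary: u b)
  case 0
  \<comment> \<open>A nonzero codeword has weight at least 2, but over a zero prefix only the last
    letter can count.\<close>
  have "u @ [b] = zero_word (Suc k)"
  proof (rule ccontr)
    assume "u @ [b] \<noteq> zero_word (Suc k)"
    from is_MDS_weight[OF C 0(2) this] show False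
      using 0(1) by (simp split: if_splits)
  qed
  then show ?case
    by (simp add: zero_word_def del: hamming_weight_append)
next
  case (Suc w)
  have len: "length u = k"
    using is_MDS_length[OF C(1) Suc(3)] by simp
  obtain i where i: "i < length u" "u ! i = 1"
  proof -
    have "{i. i < length u \<and> u ! i \<noteq> 0} \<noteq> {}"
    proof
      assume "{i. i < length u \<and> u ! i \<noteq> 0} = {}"
      then have "hamming_weight u = 0"
        by (simp only: hamming_weight_def card.empty)
      then show False using Suc(2) by simp
    qed
    then obtain i where "i < length u" "u ! i \<noteq> 0" by blast
    then show thesis by (intro that) simp_all
  qed
  let ?u = "u[i := 0]"
  \<comment> \<open>The cleared prefix also extends to a codeword, and here the tail is a single
    letter.\<close>
  obtain v where v: "length v = Suc k - k" "?u @ v \<in> C"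
    using is_MDS_prefix[OF C(1), of ?u] len by auto
  then obtain c where c: "?u @ [c] \<in> C"
    by (cases v) auto
  have "u \<noteq> ?u"
    using i by (metis nth_list_update_eq zero_neq_one)
  then have "2 \<le> hamming_dist (u @ [b]) (?u @ [c])"
    using is_MDS_dist[OF C(1) Suc(3) c] by simp
  \<comment> \<open>The prefixes differ in at most one position, so the second difference must be in
    the last letter.\<close>
  then have "b \<noteq> c"
    using hamming_dist_update_le[of u i 0] by auto
  moreover have "even (hamming_weight (?u @ [c]))"
    using Suc(1)[OF _ c] Suc(2) hamming_weight_clear_bit[OF i] by simp
  \<comment> \<open>Restoring the cleared one adds 1 and flipping the last letter adds or subtracts
    1, so the parity is unchanged.\<close>
  ultimately show ?case
    using hamming_weight_clear_bit[OF i] by (cases b; cases c) auto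
qed

lemma is_MDS_nonzero_weights_Suc:
  assumes C: "is_MDS (Suc k) k C" "zero_word (Suc k) \<in> C"
  shows "nonzero_weights (Suc k) C = {t. 1 < t \<and> t \<le> Suc k \<and> even t}"
proof (intro equalityI subsetI)
  fix t assume "t \<in> nonzero_weights (Suc k) C"
  then obtain c where c: "c \<in> C" "c \<noteq> zero_word (Suc k)" "t = hamming_weight c"
    by (auto simp: nonzero_weights_def)
  have len: "length c = Suc k"
    using is_MDS_length[OF C(1) c(1)] .
  then obtain u b where "c = u @ [b]"
    by (metis length_Suc_conv_rev)
  then have "even t"
    using is_MDS_even_weight[OF C] c by blast
  then show "t \<in> {t. 1 < t \<and> t \<le> Suc k \<and> even t}"
    using is_MDS_weight[OF C c(1,2)] hamming_weight_le_length[of c] len c(3) by auto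
next
  fix t assume "t \<in> {t. 1 < t \<and> t \<le> Suc k \<and> even t}"
  then have t: "1 < t" "t \<le> Suc k" "even t"
    by auto
  \<comment> \<open>The weight \<open>t - 1\<close> is odd, so parity forces the last letter of the
    codeword over this prefix to be 1 and its weight to be \<open>t\<close>.\<close>
  let ?u = "replicate (t - 1) 1 @ replicate (Suc k - t) (0 :: bit)"
  have "length ?u = k" using t by simp
  then obtain v where v: "length v = Suc k - k" "?u @ v \<in> C"
    using is_MDS_prefix[OF C(1), of ?u] by auto
  then obtain b where b: "?u @ [b] \<in> C"
    by (cases v) auto
  have "even (hamming_weight (?u @ [b]))"
    by (rule is_MDS_even_weight[OF C b])
  then have wt: "hamming_weight (?u @ [b]) = t"
    using t by (cases b) auto
  have "?u @ [b] \<noteq> zero_word (Suc k)"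
  proof
    assume "?u @ [b] = zero_word (Suc k)"
    then have "t = hamming_weight (zero_word (Suc k))"
      using wt by (simp only:)
    then show False
      using t by (simp add: zero_word_def)
  qed
  then have "?u @ [b] \<in> C - {zero_word (Suc k)}"
    using b by simp
  then show "t \<in> nonzero_weights (Suc k) C"
    unfolding nonzero_weights_def using wt[symmetric] by (rule image_eqI[rotated])
qed

section \<open>The extreme dimensions and the classification\<close>

lemma is_MDS_nonzero_weights_dim_1:
  assumes C: "is_MDS n 1 C" "zero_word n \<in> C" and "1 \<le> n"
  shows "nonzero_weights n C = {n}"
proof -
  \<comment> \<open>For dimension 1 the minimum distance is \<open>n\<close>, which is also the
    largest possible weight.\<close>
  have "hamming_weight c = n" if "c \<in> C - {zero_word n}" for c
    using is_MDS_weight[OF C, of c] that \<open>1 \<le> n\<close> hamming_weight_le_length[of c]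
      is_MDS_length[OF C(1), of c] by simp
  \<comment> \<open>Without a nonzero codeword the weight set would be empty instead of
    \<open>{n}\<close>; the code has two elements.\<close>
  moreover have "C - {zero_word n} \<noteq> {}"
  proof
    assume "C - {zero_word n} = {}"
    then have "card C \<le> 1"
      using card_mono[of "{zero_word n}" C] by auto
    then show False
      using C(1) by (simp add: is_MDS_def is_code_def)
  qed
  ultimately show ?thesis
    unfolding nonzero_weights_def by force
qed

lemma is_MDS_self: "is_MDS n n C \<Longrightarrow> C = words n"
  unfolding is_MDS_def is_code_def using card_subset_eq[OF finite_words] card_words by metis

theorem corollary1:
  fixes n k :: nat and C :: "bit list set"
  assumes "1 \<le> k" and "k \<le> n"
    and "is_MDS n k C"
    and "zero_word n \<in> C"
  shows "let case1 = (k = 1 \<and> nonzero_weights n C = {n});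
             case2 = (n = k \<and> k > 1 \<and> nonzero_weights n C = {1..n});
             case3 = (n = k + 1 \<and> nonzero_weights n C = {t. 1 < t \<and> t \<le> n \<and> even t})
         in (\<not> (n = 2 \<and> k = 1) \<longrightarrow> exactly_one case1 case2 case3) \<and>
            (n = 2 \<and> k = 1 \<longrightarrow> case1 \<and> \<not> case2 \<and> case3)"
proof (cases "k = 1")
  case True
  then have "nonzero_weights n C = {n}"
    using is_MDS_nonzero_weights_dim_1 assms by simp
  \<comment> \<open>For length 2 the even weights above 1 are just \<open>{2}\<close>, so the first
    and third cases hold together.\<close>
  moreover have "nonzero_weights n C = {t. 1 < t \<and> t \<le> n \<and> even t}" if "n = 2"
    using is_MDS_nonzero_weights_Suc[of k C] True that assms by (simp add: numeral_2_eq_2)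
  ultimately show ?thesis
    using True by (auto simp: exactly_one_def Let_def)
next
  case False
  then have "1 < k" using assms by simp
  \<comment> \<open>With \<open>1 < k\<close> the first case is excluded, and the value of
    \<open>n\<close> decides between the other two.\<close>
  then consider "n = k" | "n = Suc k"
    using is_MDS_length_le[OF assms(3,4,2)] assms(2) by linarith
  then show ?thesis
  proof cases
    case 1
    then have "nonzero_weights n C = {1..n}"
      using is_MDS_self words_nonzero_weights assms by metis
    then show ?thesis
      using 1 \<open>1 < k\<close> by (auto simp: exactly_one_def Let_def)
  next
    case 2
    then have "nonzero_weights n C = {t. 1 < t \<and> t \<le> n \<and> even t}"
      using is_MDS_nonzero_weights_Suc assms by blast
    then show ?thesis
      using 2 \<open>1 < k\<close> by (auto simp: exactly_one_def Let_def)
  qed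
qed

end
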